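(* Let $k>1$ be an integer and $n=2k-2$. Then $\mathrm{cat}_{X_{2k-2,k}}\mathrm{Sp}(k)\leq 3$.
   Context: $\mathbb{H}$ denotes the quaternions, $M^*$ the conjugate transpose of a quaternionic matrix $M$. $\mathrm{Sp}(k)$ is the Lie group of matrices $P\in\mathbb{H}^{k\times k}$ with $PP^*=I_k$. For $0<k\leq n$, the quaternionic Stiefel manifold $X_{n,k}$ is the space of matrices $x\in\mathbb{H}^{n\times k}$ with $x^*x=I_k$. The group $\mathrm{Sp}(k)$ is regarded as a subspace of $X_{n,k}$ via the canonical inclusion $\iota_{n,k}\colon \mathrm{Sp}(k)\to X_{n,k}$, $P\mapsto\begin{bmatrix}0\\ P\end{bmatrix}$ (with $0\in\mathbb{H}^{(n-k)\times k}$). For a subspace $A$ of a topological space $X$, the subspace LS-category $\mathrm{cat}_X A$ is the least integer $m\geq 0$ such that there exist $m+1$ open subsets of $X$ whose union contains $A$ and each of which is contractible in $X$ (i.e. its inclusion in $X$ is homotopic to a constant map). *)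

theory Defs
  imports
    "HOL-Analysis.Analysis"
    "Jordan_Normal_Form.Matrix"
    "HOL-Library.Extended_Nat"
begin

section \<open>Quaternions\<close>

codatatype quat = Quat (qRe: real) (qI: real) (qJ: real) (qK: real)

lemma quat_eq_iff: "x = y \<longleftrightarrow> qRe x = qRe y \<and> qI x = qI y \<and> qJ x = qJ y \<and> qK x = qK y"
  by (auto intro: quat.expand)

instantiation quat :: ab_group_add
begin

primcorec zero_quat where
  "qRe 0 = 0" | "qI 0 = 0" | "qJ 0 = 0" | "qK 0 = 0"

primcorec plus_quat where
  "qRe (x + y) = qRe x + qRe y"
| "qI (x + y) = qI x + qI y"
| "qJ (x + y) = qJ x + qJ y"
| "qK (x + y) = qK x + qK y"

primcorec uminus_quat where
  "qRe (- x) = - qRe x"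
| "qI (- x) = - qI x"
| "qJ (- x) = - qJ x"
| "qK (- x) = - qK x"

primcorec minus_quat where
  "qRe (x - y) = qRe x - qRe y"
| "qI (x - y) = qI x - qI y"
| "qJ (x - y) = qJ x - qJ y"
| "qK (x - y) = qK x - qK y"

instance by standard (simp_all add: quat_eq_iff)

end

text \<open>Hamilton's product: \<open>i\<^sup>2 = j\<^sup>2 = k\<^sup>2 = i j k = - 1\<close>.\<close>

instantiation quat :: ring_1
begin

primcorec one_quat where
  "qRe 1 = 1" | "qI 1 = 0" | "qJ 1 = 0" | "qK 1 = 0"

primcorec times_quat where
  "qRe (x * y) = qRe x * qRe y - qI x * qI y - qJ x * qJ y - qK x * qK y"
| "qI (x * y) = qRe x * qI y + qI x * qRe y + qJ x * qK y - qK x * qJ y"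
| "qJ (x * y) = qRe x * qJ y - qI x * qK y + qJ x * qRe y + qK x * qI y"
| "qK (x * y) = qRe x * qK y + qI x * qJ y - qJ x * qI y + qK x * qRe y"

instance by standard (simp_all add: quat_eq_iff algebra_simps)

end

primcorec qcnj :: "quat \<Rightarrow> quat" where
  "qRe (qcnj x) = qRe x"
| "qI (qcnj x) = - qI x"
| "qJ (qcnj x) = - qJ x"
| "qK (qcnj x) = - qK x"

instantiation quat :: real_vector
begin

primcorec scaleR_quat where
  "qRe (scaleR r x) = r * qRe x"
| "qI (scaleR r x) = r * qI x"
| "qJ (scaleR r x) = r * qJ x"
| "qK (scaleR r x) = r * qK x"

instance by standard (simp_all add: quat_eq_iff algebra_simps)

end

text \<open>The topology is that of \<open>\<real>\<^sup>4\<close>, induced by the Euclidean norm.\<close>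

instantiation quat :: real_inner
begin

definition inner_quat :: "quat \<Rightarrow> quat \<Rightarrow> real" where
  "inner_quat x y = qRe x * qRe y + qI x * qI y + qJ x * qJ y + qK x * qK y"

definition norm_quat :: "quat \<Rightarrow> real" where
  "norm_quat x = sqrt (inner x x)"

definition sgn_quat :: "quat \<Rightarrow> quat" where
  "sgn_quat x = x /\<^sub>R norm x"

definition dist_quat :: "quat \<Rightarrow> quat \<Rightarrow> real" where
  "dist_quat x y = norm (x - y)"

definition uniformity_quat :: "(quat \<times> quat) filter" where
  "uniformity_quat = (INF e\<in>{0 <..}. principal {(x, y). dist x y < e})"

definition open_quat :: "quat set \<Rightarrow> bool" where
  "open_quat U \<longleftrightarrow> (\<forall>x\<in>U. eventually (\<lambda>(x', y). x' = x \<longrightarrow> y \<in> U) uniformity)"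

instance
proof
  fix x y z :: quat and r :: real
  show "inner x y = inner y x" "inner (x + y) z = inner x z + inner y z"
    "inner (r *\<^sub>R x) y = r * inner x y"
    by (simp_all add: inner_quat_def algebra_simps)
  show "0 \<le> inner x x" by (simp add: inner_quat_def)
  show "inner x x = 0 \<longleftrightarrow> x = 0"
    by (simp add: inner_quat_def quat_eq_iff add_nonneg_eq_0_iff)
qed (simp_all add: dist_quat_def sgn_quat_def norm_quat_def uniformity_quat_def open_quat_def)

end

instantiation quat :: division_ring
begin

definition inverse_quat :: "quat \<Rightarrow> quat" where
  "inverse_quat x = qcnj x /\<^sub>R inner x x"

definition divide_quat :: "quat \<Rightarrow> quat \<Rightarrow> quat" where
  "divide_quat x y = x * inverse y"

instance
proof
  fix x y :: quat
  have mult: "x * qcnj x = inner x x *\<^sub>R 1" "qcnj x * x = inner x x *\<^sub>R 1"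
    by (simp_all add: quat_eq_iff inner_quat_def algebra_simps)
  have scale: "x * r *\<^sub>R y = r *\<^sub>R (x * y)" "r *\<^sub>R y * x = r *\<^sub>R (y * x)" for r and y :: quat
    by (simp_all add: quat_eq_iff algebra_simps)
  assume "x \<noteq> 0"
  then show "x * inverse x = 1" "inverse x * x = 1"
    by (simp_all add: inverse_quat_def scale mult del: scaleR_quat.simps)
qed (simp_all add: inverse_quat_def divide_quat_def quat_eq_iff)

end

instance quat :: real_normed_div_algebra
proof
  fix x y :: quat and r :: real
  show "r *\<^sub>R x * y = r *\<^sub>R (x * y)" "x * r *\<^sub>R y = r *\<^sub>R (x * y)"
    by (simp_all add: quat_eq_iff algebra_simps)
  show "norm (x * y) = norm x * norm y"
    by (simp add: norm_quat_def inner_quat_def real_sqrt_mult [symmetric] algebra_simps)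
qed


section \<open>Quaternionic matrices, \<open>Sp(k)\<close> and Stiefel manifolds\<close>

definition qadjoint :: "quat mat \<Rightarrow> quat mat" where
  "qadjoint M = map_mat qcnj (transpose_mat M)"

definition Sp :: "nat \<Rightarrow> quat mat set" where
  "Sp k = {P \<in> carrier_mat k k. P * qadjoint P = 1\<^sub>m k}"

definition stiefel :: "nat \<Rightarrow> nat \<Rightarrow> quat mat set" where
  "stiefel n k = {x \<in> carrier_mat n k. qadjoint x * x = 1\<^sub>m k}"

text \<open>The space of \<open>n \<times> k\<close> matrices carries the product topology of its \<open>n k\<close> entries, transported
  to \<^term>\<open>carrier_mat n k\<close> along the bijection sending a matrix to its family of entries.\<close>

definition mat_topology :: "nat \<Rightarrow> nat \<Rightarrow> quat mat topology" where
  "mat_topology n k =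
     pullback_topology (carrier_mat n k) (\<lambda>M. \<lambda>ij\<in>{..<n} \<times> {..<k}. M $$ ij)
       (product_topology (\<lambda>_. euclidean) ({..<n} \<times> {..<k}))"

definition stiefel_space :: "nat \<Rightarrow> nat \<Rightarrow> quat mat topology" where
  "stiefel_space n k = subtopology (mat_topology n k) (stiefel n k)"

lemma topspace_stiefel_space [simp]: "topspace (stiefel_space n k) = stiefel n k"
  by (auto simp: stiefel_space_def mat_topology_def topspace_pullback_topology stiefel_def)

text \<open>\<^term>\<open>A @\<^sub>r B\<close> puts \<^term>\<open>A\<close> on top of \<^term>\<open>B\<close>.\<close>

definition stiefel_incl :: "nat \<Rightarrow> nat \<Rightarrow> quat mat \<Rightarrow> quat mat" where
  "stiefel_incl n k P = 0\<^sub>m (n - k) k @\<^sub>r P"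


section \<open>Subspace LS-category\<close>

definition contractible_in :: "'a topology \<Rightarrow> 'a set \<Rightarrow> bool" where
  "contractible_in X U \<longleftrightarrow>
     (\<exists>c. homotopic_with (\<lambda>_. True) (subtopology X U) X (\<lambda>x. x) (\<lambda>_. c))"

text \<open>The value is \<open>\<infinity>\<close> if no finite cover of the required kind exists.\<close>

definition subspace_cat :: "'a topology \<Rightarrow> 'a set \<Rightarrow> enat" where
  "subspace_cat X A =
     Inf {enat m | m. \<exists>U :: nat \<Rightarrow> 'a set.
            (\<forall>i\<le>m. openin X (U i) \<and> contractible_in X (U i)) \<and> A \<subseteq> (\<Union>i\<le>m. U i)}"

end

theory Submission
  imports Defs
begin

text \<open>
  Put \<open>m = k - 2\<close>, so that \<open>n = 2 m + 2\<close>, and write a point of the Stiefel manifold as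
  \<open>x = [T; P]\<close>, where \<open>T\<close> consists of the first \<open>m\<close> rows; \<open>Sp(k)\<close> is the part with \<open>T = 0\<close>.
  Gram-Schmidt orthonormalization is continuous on all \<open>n \<times> k\<close> matrices with right-linearly
  independent columns (frames) and fixes the Stiefel manifold.  It therefore suffices to join maps
  by straight segments that run through frames (\<open>homotopic_orthonormalize\<close>); no unit length or
  orthogonality has to be kept along the way.

  If \<open>T\<close> is small, then \<open>P\<close> alone is a frame (\<open>frame_lower_rows\<close>), and \<open>T\<close> can be moved to \<open>0\<close>.
  The \<open>m\<close> zero rows then give room to replace the first \<open>m\<close> columns by the first \<open>m\<close> unit vectors:
  along \<open>[r I, 0; (1 - r) P', P'']\<close> the columns remain independent, whatever \<open>P\<close> is.  Only the last
  two columns \<open>u, v\<close> of \<open>P\<close> survive, so that the problem becomes that of contracting an independent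
  pair \<open>(u, v)\<close> of quaternionic vectors.

  This is a fibration argument for \<open>(u, v) \<mapsto> u\<close>, whose base and fibre are spheres up to homotopy:
  each is covered by two contractible open sets, which yields \<open>2 \<cdot> 2 = 4\<close> sets upstairs.  With signs
  \<open>s, t\<close>, the vector \<open>u\<close> is moved to \<open>s e\<close> away from the opposite vector, and afterwards \<open>v\<close> is
  moved to \<open>t f\<close>, where \<open>e, f\<close> are the unit vectors of the rows \<open>m\<close> and \<open>m + 1\<close>.  To keep the pair
  independent while \<open>u\<close> moves, \<open>v\<close> is first sheared along \<open>u\<close> into the kernel of a functional that
  does not vanish anywhere on the segment from \<open>u\<close> to \<open>s e\<close>
  (\<open>pivot_form_shear\<close>, \<open>independent_pair_kernel\<close>).  The homotopies are assembled in
  \<open>contractible_categorical_set\<close>, and \<open>categorical_sets_cover\<close> shows that for every point of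
  \<open>Sp(k)\<close> some choice of signs works.
\<close>

section \<open>Quaternionic conjugation and the Hermitian product\<close>

lemma qcnj_0 [simp]: "qcnj 0 = 0"
  and qcnj_add: "qcnj (x + y) = qcnj x + qcnj y"
  and qcnj_mult: "qcnj (x * y) = qcnj y * qcnj x"
  and qcnj_scaleR: "qcnj (r *\<^sub>R x) = r *\<^sub>R qcnj x"
  and qcnj_qcnj [simp]: "qcnj (qcnj x) = x"
  by (simp_all add: quat_eq_iff algebra_simps)

lemma norm_quat_sq: "(norm x)\<^sup>2 = (qRe x)\<^sup>2 + (qI x)\<^sup>2 + (qJ x)\<^sup>2 + (qK x)\<^sup>2" for x :: quat
  by (simp add: norm_quat_def inner_quat_def power2_eq_square)

lemma qcnj_mult_self: "qcnj x * x = of_real ((norm x)\<^sup>2)"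
  unfolding of_real_def norm_quat_sq by (simp add: quat_eq_iff power2_eq_square)

lemma norm_qcnj [simp]: "norm (qcnj x) = norm x"
  by (simp add: norm_quat_def inner_quat_def)

lemma qRe_of_real [simp]: "qRe (of_real r) = r"
  by (simp add: of_real_def)

lemma qRe_sum: "qRe (sum f A) = (\<Sum>a\<in>A. qRe (f a))"
  by (induction A rule: infinite_finite_induct) simp_all

lemma qcnj_sum: "qcnj (sum f A) = (\<Sum>a\<in>A. qcnj (f a))"
  by (induction A rule: infinite_finite_induct) (simp_all add: qcnj_add)

lemma bounded_linear_qcnj: "bounded_linear qcnj"
  by (rule bounded_linear_intro [where K = 1]) (simp_all add: qcnj_add qcnj_scaleR)

lemmas tendsto_qcnj [tendsto_intros] = bounded_linear.tendsto [OF bounded_linear_qcnj]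

lemma abs_qRe_le_norm: "\<bar>qRe x\<bar> \<le> norm x"
  by (rule abs_le_square_iff [THEN iffD2, of _ "norm x", simplified]) (simp add: norm_quat_sq)

lemma bounded_linear_qRe: "bounded_linear qRe"
  by (rule bounded_linear_intro [where K = 1]) (simp_all add: abs_qRe_le_norm)

lemmas tendsto_qRe [tendsto_intros] = bounded_linear.tendsto [OF bounded_linear_qRe]

text \<open>The standard Hermitian product, conjugate-linear on the left.  Scalars act on vectors from the
  right, so that it is right-linear in its second argument.\<close>

definition hip :: "'i set \<Rightarrow> ('i \<Rightarrow> quat) \<Rightarrow> ('i \<Rightarrow> quat) \<Rightarrow> quat" where
  "hip I u v = (\<Sum>i\<in>I. qcnj (u i) * v i)"

lemma hip_add_right: "hip I u (\<lambda>i. v i + w i) = hip I u v + hip I u w"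
  and hip_diff_right: "hip I u (\<lambda>i. v i - w i) = hip I u v - hip I u w"
  and hip_mult_right: "hip I u (\<lambda>i. v i * c) = hip I u v * c"
  and hip_scaleR_right: "hip I u (\<lambda>i. r *\<^sub>R v i) = r *\<^sub>R hip I u v"
  and hip_scaleR_left: "hip I (\<lambda>i. r *\<^sub>R u i) v = r *\<^sub>R hip I u v"
  and hip_commute: "qcnj (hip I u v) = hip I v u"
  by (simp_all add: hip_def distrib_left right_diff_distrib sum.distrib sum_subtractf
      sum_distrib_right mult.assoc scaleR_sum_right qcnj_scaleR qcnj_sum qcnj_mult)

lemma hip_sum_right: "hip I u (\<lambda>i. \<Sum>j\<in>J. v j i) = (\<Sum>j\<in>J. hip I u (v j))"
  unfolding hip_def by (simp add: sum_distrib_left) (rule sum.swap)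

lemma hip_self: "hip I u u = of_real (\<Sum>i\<in>I. (norm (u i))\<^sup>2)"
  by (simp add: hip_def qcnj_mult_self)

lemma hip_self_eq_0_iff:
  assumes "finite I"
  shows "hip I u u = 0 \<longleftrightarrow> (\<forall>i\<in>I. u i = 0)"
  using assms unfolding hip_self of_real_eq_0_iff by (simp add: sum_nonneg_eq_0_iff)

lemma tendsto_hip:
  assumes "\<And>i. i \<in> I \<Longrightarrow> ((\<lambda>z. f z i) \<longlongrightarrow> u i) F" "\<And>i. i \<in> I \<Longrightarrow> ((\<lambda>z. g z i) \<longlongrightarrow> v i) F"
  shows "((\<lambda>z. hip I (f z) (g z)) \<longlongrightarrow> hip I u v) F"
  unfolding hip_def by (intro tendsto_intros assms)

section \<open>Frames and their orthonormalization\<close>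

definition frame :: "'i set \<Rightarrow> nat \<Rightarrow> (nat \<Rightarrow> 'i \<Rightarrow> quat) \<Rightarrow> bool" where
  "frame I k X \<longleftrightarrow>
     (\<forall>a. (\<forall>i\<in>I. (\<Sum>j<k. X j i * a j) = 0) \<longrightarrow> (\<forall>j<k. a j = 0))"

definition orthonormal :: "'i set \<Rightarrow> nat \<Rightarrow> (nat \<Rightarrow> 'i \<Rightarrow> quat) \<Rightarrow> bool" where
  "orthonormal I k X \<longleftrightarrow> (\<forall>j<k. \<forall>l<k. hip I (X j) (X l) = (if j = l then 1 else 0))"

text \<open>The Gram-Schmidt remainder of \<open>v\<close> against the first \<open>j\<close> vectors of \<open>X\<close>.  Carrying an arbitrary
  vector \<open>v\<close> along turns the process into a primitive recursion: the next direction to be projected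
  away is the remainder of \<open>X j\<close> itself.\<close>

primrec residual :: "'i set \<Rightarrow> (nat \<Rightarrow> 'i \<Rightarrow> quat) \<Rightarrow> nat \<Rightarrow> ('i \<Rightarrow> quat) \<Rightarrow> 'i \<Rightarrow> quat" where
  "residual I X 0 = (\<lambda>v. v)"
| "residual I X (Suc j) = (\<lambda>v.
     let p = residual I X j (X j); w = residual I X j v
     in (\<lambda>i. w i - p i * (inverse (hip I p p) * hip I p w)))"

definition gram_schmidt :: "'i set \<Rightarrow> (nat \<Rightarrow> 'i \<Rightarrow> quat) \<Rightarrow> nat \<Rightarrow> 'i \<Rightarrow> quat" where
  "gram_schmidt I X j =
     (let p = residual I X j (X j) in (\<lambda>i. p i /\<^sub>R sqrt (qRe (hip I p p))))"

text \<open>Each step subtracts the component along a new direction \<open>p\<close> that is itself orthogonal to the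
  earlier ones.  When \<open>p\<close> vanishes on \<open>I\<close>, the convention \<open>inverse 0 = 0\<close> makes the subtraction
  trivial, in accordance with \<open>p\<close> being orthogonal to everything.\<close>

lemma residual_orthogonal:
  assumes "finite I" "i < j"
  shows "hip I (residual I X i (X i)) (residual I X j v) = 0"
  using assms(2)
proof (induction j arbitrary: i v)
  case (Suc j)
  define p where "p = residual I X j (X j)"
  define w where "w = residual I X j v"
  have *: "hip I u (residual I X (Suc j) v) = hip I u w - hip I u p * (inverse (hip I p p) * hip I p w)" for u
    by (simp add: p_def w_def Let_def hip_diff_right hip_mult_right)
  show ?case
  proof (cases "i = j")
    case True
    show ?thesis
    proof (cases "hip I p p = 0")
      case z: True
      then have "hip I p w = 0"
        using assms(1) by (simp add: hip_self_eq_0_iff) (simp add: hip_def)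
      then show ?thesis using * [of p] True by (simp add: p_def)
    next
      case False
      then show ?thesis using * [of p] True by (simp add: p_def mult.assoc [symmetric])
    qed
  next
    case False
    then have "i < j" using Suc.prems by simp
    then show ?thesis using * Suc.IH by (simp add: p_def w_def)
  qed
qed simp

lemma residual_combination: "\<exists>a. \<forall>i. residual I X j v i = v i - (\<Sum>l<j. X l i * a l)"
proof (induction j arbitrary: v)
  case (Suc j)
  define p where "p = residual I X j (X j)"
  define w where "w = residual I X j v"
  define c where "c = inverse (hip I p p) * hip I p w"
  obtain a where a: "\<And>i. w i = v i - (\<Sum>l<j. X l i * a l)"
    using Suc.IH unfolding w_def by blast
  obtain b where b: "\<And>i. p i = X j i - (\<Sum>l<j. X l i * b l)"
    using Suc.IH unfolding p_def by blast
  have "residual I X (Suc j) v i = v i - (\<Sum>l<Suc j. X l i * (if l = j then c else a l - b l * c))" for i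
  proof -
    have "residual I X (Suc j) v i = w i - p i * c"
      by (simp add: p_def w_def c_def Let_def)
    also have "\<dots> = v i - ((\<Sum>l<j. X l i * (a l - b l * c)) + X j i * c)"
      by (simp add: a b algebra_simps sum_subtractf sum_distrib_right)
    finally show ?thesis by simp
  qed
  then show ?case by (intro exI allI)
qed simp

text \<open>A vanishing remainder would exhibit \<open>X j\<close> as a right-linear combination of its
  predecessors.\<close>

lemma residual_nonzero:
  assumes "finite I" "frame I k X" "j < k"
  shows "hip I (residual I X j (X j)) (residual I X j (X j)) \<noteq> 0"
proof
  assume "hip I (residual I X j (X j)) (residual I X j (X j)) = 0"
  then have z: "\<forall>i\<in>I. residual I X j (X j) i = 0"
    using assms(1) by (simp add: hip_self_eq_0_iff)
  obtain a where a: "\<And>i. residual I X j (X j) i = X j i - (\<Sum>l<j. X l i * a l)"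
    using residual_combination by blast
  define b where "b l = (if l = j then 1 else if l < j then - a l else 0)" for l
  have "(\<Sum>l<k. X l i * b l) = 0" if "i \<in> I" for i
  proof -
    have "(\<Sum>l<k. X l i * b l) = (\<Sum>l<Suc j. X l i * b l)"
      using assms(3) by (intro sum.mono_neutral_right) (auto simp: b_def)
    also have "\<dots> = X j i - (\<Sum>l<j. X l i * a l)"
      by (simp add: b_def sum_negf)
    finally show ?thesis using a z that by simp
  qed
  then have "b j = 0" using assms(2,3) unfolding frame_def by blast
  then show False by (simp add: b_def)
qed

text \<open>Nothing is subtracted from a vector that is already orthogonal to its predecessors; this is why
  orthonormalization is a retraction.\<close>

lemma residual_eq_self:
  assumes "\<And>i l. i < j \<Longrightarrow> l < i \<Longrightarrow> hip I (X l) (X i) = 0" "\<And>i. i < j \<Longrightarrow> hip I (X i) v = 0"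
  shows "residual I X j v = v"
  using assms
proof (induction j arbitrary: v)
  case (Suc j)
  have "residual I X j v = v" "residual I X j (X j) = X j"
    by (rule Suc.IH; simp add: Suc.prems)+
  then show ?case by (simp add: Suc.prems Let_def)
qed simp

lemma orthonormal_gram_schmidt:
  assumes I: "finite I" and X: "frame I k X"
  shows "orthonormal I k (gram_schmidt I X)"
  unfolding orthonormal_def
proof (intro allI impI)
  fix j l assume jl: "j < k" "l < k"
  let ?p = "\<lambda>j. residual I X j (X j)"
  have gs: "hip I (gram_schmidt I X j) (gram_schmidt I X l) =
      inverse (sqrt (qRe (hip I (?p j) (?p j)))) *\<^sub>R inverse (sqrt (qRe (hip I (?p l) (?p l)))) *\<^sub>R
        hip I (?p j) (?p l)"
    by (simp only: gram_schmidt_def Let_def hip_scaleR_left hip_scaleR_right)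
  show "hip I (gram_schmidt I X j) (gram_schmidt I X l) = (if j = l then 1 else 0)"
  proof (cases "j = l")
    case True
    define s where "s = (\<Sum>i\<in>I. (norm (?p j i))\<^sup>2)"
    have hs: "hip I (?p j) (?p j) = of_real s" by (simp add: s_def hip_self)
    then have "s \<noteq> 0" using residual_nonzero [OF I X jl(1)] by auto
    moreover have "s \<ge> 0" by (simp add: s_def sum_nonneg)
    ultimately have "inverse (sqrt s) * inverse (sqrt s) * s = 1"
      by (simp add: field_simps)
    then have "inverse (sqrt s) *\<^sub>R inverse (sqrt s) *\<^sub>R of_real s = (1 :: quat)"
      by (simp add: of_real_def mult.assoc)
    then show ?thesis using True gs hs by simp
  next
    case False
    have "hip I (?p j) (?p l) = 0"
    proof (cases "j < l")
      case True
      then show ?thesis using residual_orthogonal [OF I] by blast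
    next
      case f: False
      then have "hip I (?p l) (?p j) = 0" using residual_orthogonal [OF I] False by simp
      then show ?thesis using hip_commute [of I "?p l" "?p j"] by simp
    qed
    then show ?thesis using gs False by simp
  qed
qed

lemma gram_schmidt_orthonormal:
  assumes "orthonormal I k X" "j < k"
  shows "gram_schmidt I X j = X j"
proof -
  have "residual I X j (X j) = X j"
    using assms by (intro residual_eq_self) (auto simp: orthonormal_def)
  moreover have "hip I (X j) (X j) = 1"
    using assms by (simp add: orthonormal_def)
  ultimately show ?thesis by (simp add: gram_schmidt_def)
qed

text \<open>The inverse in the recursion is continuous at a frame because no pivot vanishes there.\<close>

lemma tendsto_residual:
  assumes I: "finite I" and X: "frame I k X" and "j \<le> k"
    and F: "\<And>j i. j < k \<Longrightarrow> i \<in> I \<Longrightarrow> ((\<lambda>z. F z j i) \<longlongrightarrow> X j i) H"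
    and "\<And>i. i \<in> I \<Longrightarrow> ((\<lambda>z. f z i) \<longlongrightarrow> v i) H" and "i \<in> I"
  shows "((\<lambda>z. residual I (F z) j (f z) i) \<longlongrightarrow> residual I X j v i) H"
  using assms(3,5,6)
proof (induction j arbitrary: f v i)
  case (Suc j)
  have p: "((\<lambda>z. residual I (F z) j (F z j) i) \<longlongrightarrow> residual I X j (X j) i) H" if "i \<in> I" for i
    using Suc.prems that by (intro Suc.IH F) auto
  have w: "((\<lambda>z. residual I (F z) j (f z) i) \<longlongrightarrow> residual I X j v i) H" if "i \<in> I" for i
    using Suc.prems that by (intro Suc.IH) auto
  have "hip I (residual I X j (X j)) (residual I X j (X j)) \<noteq> 0"
    using Suc.prems by (intro residual_nonzero [OF I X]) auto
  then show ?case
    unfolding residual.simps Let_def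
    by (intro tendsto_intros tendsto_hip p w Suc.prems)
qed simp

lemma tendsto_gram_schmidt:
  assumes I: "finite I" and X: "frame I k X"
    and F: "\<And>j i. j < k \<Longrightarrow> i \<in> I \<Longrightarrow> ((\<lambda>z. F z j i) \<longlongrightarrow> X j i) H"
    and "j < k" "i \<in> I"
  shows "((\<lambda>z. gram_schmidt I (F z) j i) \<longlongrightarrow> gram_schmidt I X j i) H"
proof -
  have p: "((\<lambda>z. residual I (F z) j (F z j) i) \<longlongrightarrow> residual I X j (X j) i) H" if "i \<in> I" for i
    using that assms(4) by (intro tendsto_residual [OF I X _ F] F) auto
  have "hip I (residual I X j (X j)) (residual I X j (X j)) \<noteq> 0"
    by (intro residual_nonzero [OF I X] assms)
  then have "sqrt (qRe (hip I (residual I X j (X j)) (residual I X j (X j)))) \<noteq> 0"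
    unfolding hip_self by (metis of_real_0 qRe_of_real real_sqrt_eq_zero_cancel_iff)
  then show ?thesis
    unfolding gram_schmidt_def Let_def
    by (intro tendsto_intros tendsto_hip p assms)
qed


section \<open>The Stiefel manifold in coordinates\<close>

abbreviation column_family :: "'a mat \<Rightarrow> nat \<Rightarrow> nat \<Rightarrow> 'a" where
  "column_family M \<equiv> (\<lambda>j i. M $$ (i, j))"

text \<open>Expressing continuity by limits makes the rules for sums, products, inverses and norms of
  limits applicable to maps on an arbitrary topological space.\<close>

lemma continuous_map_euclidean_iff_tendsto:
  "continuous_map Z euclidean f \<longleftrightarrow> (\<forall>z\<in>topspace Z. (f \<longlongrightarrow> f z) (atin Z z))"
  by (simp add: continuous_map_atin)

lemma continuous_map_mat_topology:
  assumes "\<And>z. z \<in> topspace Z \<Longrightarrow> f z \<in> carrier_mat n k"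
    and "\<And>i j. i < n \<Longrightarrow> j < k \<Longrightarrow> continuous_map Z euclidean (\<lambda>z. f z $$ (i, j))"
  shows "continuous_map Z (mat_topology n k) f"
  unfolding mat_topology_def
proof (rule continuous_map_pullback')
  show "continuous_map Z (product_topology (\<lambda>_. euclidean) ({..<n} \<times> {..<k}))
      ((\<lambda>M. \<lambda>ij\<in>{..<n} \<times> {..<k}. M $$ ij) \<circ> f)"
    using assms(2) by (auto simp: continuous_map_componentwise o_def)
qed (use assms(1) in auto)

lemma continuous_map_entry:
  assumes "i < n" "j < k"
  shows "continuous_map (stiefel_space n k) euclidean (\<lambda>M. M $$ (i, j))"
proof -
  have "continuous_map (mat_topology n k) euclidean
      ((\<lambda>f. f (i, j)) \<circ> (\<lambda>M. \<lambda>ij\<in>{..<n} \<times> {..<k}. M $$ ij))"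
    unfolding mat_topology_def
    by (intro continuous_map_pullback continuous_map_product_projection) (use assms in auto)
  then show ?thesis
    using assms by (simp add: o_def stiefel_space_def continuous_map_from_subtopology)
qed

lemma qadjoint_carrier [simp]: "M \<in> carrier_mat n k \<Longrightarrow> qadjoint M \<in> carrier_mat k n"
  by (simp add: qadjoint_def)

lemma qadjoint_mult_entry:
  assumes "M \<in> carrier_mat n k" "j < k" "l < k"
  shows "(qadjoint M * M) $$ (j, l) = hip {..<n} (column_family M j) (column_family M l)"
  using assms by (auto simp: qadjoint_def scalar_prod_def hip_def atLeast0LessThan intro!: sum.cong)

lemma stiefel_iff_orthonormal:
  "M \<in> stiefel n k \<longleftrightarrow> M \<in> carrier_mat n k \<and> orthonormal {..<n} k (column_family M)"
proof (cases "M \<in> carrier_mat n k")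
  case True
  then have "qadjoint M * M \<in> carrier_mat k k"
    by (meson mult_carrier_mat qadjoint_carrier)
  then have "qadjoint M * M = 1\<^sub>m k \<longleftrightarrow>
      (\<forall>j<k. \<forall>l<k. (qadjoint M * M) $$ (j, l) = (if j = l then 1 else 0))"
    by (auto intro!: eq_matI)
  then show ?thesis
    using True by (simp add: stiefel_def orthonormal_def qadjoint_mult_entry)
qed (simp add: stiefel_def)

definition orthonormalize :: "nat \<Rightarrow> nat \<Rightarrow> (nat \<Rightarrow> nat \<Rightarrow> quat) \<Rightarrow> quat mat" where
  "orthonormalize n k X = mat n k (\<lambda>(i, j). gram_schmidt {..<n} X j i)"

lemma orthonormalize_in_stiefel:
  assumes "frame {..<n} k X"
  shows "orthonormalize n k X \<in> stiefel n k"
proof -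
  have "orthonormal {..<n} k (gram_schmidt {..<n} X)"
    using assms by (rule orthonormal_gram_schmidt [OF finite_lessThan])
  then show ?thesis
    by (simp add: stiefel_iff_orthonormal orthonormalize_def orthonormal_def hip_def)
qed

lemma orthonormalize_columns:
  assumes "M \<in> stiefel n k"
  shows "orthonormalize n k (column_family M) = M"
proof -
  have M: "M \<in> carrier_mat n k" "orthonormal {..<n} k (column_family M)"
    using assms by (simp_all add: stiefel_iff_orthonormal)
  then show ?thesis
    by (auto simp: orthonormalize_def gram_schmidt_orthonormal [OF M(2)] intro!: eq_matI)
qed

lemma continuous_map_orthonormalize:
  assumes F: "\<And>i j. i < n \<Longrightarrow> j < k \<Longrightarrow> continuous_map Z euclidean (\<lambda>z. F z j i)"
    and fr: "\<And>z. z \<in> topspace Z \<Longrightarrow> frame {..<n} k (F z)"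
  shows "continuous_map Z (stiefel_space n k) (\<lambda>z. orthonormalize n k (F z))"
proof -
  have "continuous_map Z (mat_topology n k) (\<lambda>z. orthonormalize n k (F z))"
  proof (rule continuous_map_mat_topology)
    fix i j assume ij: "i < n" "j < k"
    have "((\<lambda>z. gram_schmidt {..<n} (F z) j i) \<longlongrightarrow> gram_schmidt {..<n} (F z) j i) (atin Z z)"
      if "z \<in> topspace Z" for z
      using ij that F by (intro tendsto_gram_schmidt [OF _ fr]) (auto simp: continuous_map_euclidean_iff_tendsto)
    then show "continuous_map Z euclidean (\<lambda>z. orthonormalize n k (F z) $$ (i, j))"
      using ij by (simp add: orthonormalize_def continuous_map_euclidean_iff_tendsto)
  qed (simp add: orthonormalize_def)
  then show ?thesis
    using orthonormalize_in_stiefel fr by (auto simp: stiefel_space_def continuous_map_in_subtopology)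
qed

text \<open>The only source of homotopies below: segments in the vector space of all matrices that stay
  inside the open set of frames, pushed into the Stiefel manifold by orthonormalization.\<close>

lemma homotopic_orthonormalize:
  assumes F: "\<And>i j. i < n \<Longrightarrow> j < k \<Longrightarrow> continuous_map Z euclidean (\<lambda>z. F z j i)"
    and G: "\<And>i j. i < n \<Longrightarrow> j < k \<Longrightarrow> continuous_map Z euclidean (\<lambda>z. G z j i)"
    and fr: "\<And>z t. z \<in> topspace Z \<Longrightarrow> 0 \<le> t \<Longrightarrow> t \<le> 1 \<Longrightarrow>
        frame {..<n} k (\<lambda>j i. (1 - t) *\<^sub>R F z j i + t *\<^sub>R G z j i)"
  shows "homotopic_with (\<lambda>_. True) Z (stiefel_space n k)
    (\<lambda>z. orthonormalize n k (F z)) (\<lambda>z. orthonormalize n k (G z))"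
proof -
  let ?P = "prod_topology (top_of_set {0..1::real}) Z"
  let ?H = "\<lambda>p j i. (1 - fst p) *\<^sub>R F (snd p) j i + fst p *\<^sub>R G (snd p) j i"
  have snd: "continuous_map ?P euclidean (\<lambda>p. f (snd p))"
    if "continuous_map Z euclidean f" for f :: "'a \<Rightarrow> quat"
    using continuous_map_compose [OF continuous_map_snd that, of "top_of_set {0..1::real}"]
    by (simp add: o_def)
  have fst: "continuous_map ?P euclideanreal fst"
    using continuous_map_fst [of "top_of_set {0..1::real}" Z] continuous_map_into_fulltopology by blast
  have "continuous_map ?P euclidean (\<lambda>p. ?H p j i)" if "i < n" "j < k" for i j
    using snd [OF F [OF that]] snd [OF G [OF that]] fst
    unfolding continuous_map_euclidean_iff_tendsto by (auto intro!: tendsto_intros)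
  then have "continuous_map ?P (stiefel_space n k) (\<lambda>p. orthonormalize n k (?H p))"
    by (rule continuous_map_orthonormalize) (use fr in auto)
  then show ?thesis
    unfolding homotopic_with_def by (intro exI conjI) auto
qed

section \<open>Unitary matrices have orthonormal columns\<close>

text \<open>Membership in \<open>Sp k\<close> says that the rows of \<open>P\<close> are orthonormal.  For the columns, look at
  \<open>E = P^* P\<close>: it is Hermitian and idempotent, so its squared Frobenius norm equals its real trace.
  The real part of a trace is invariant under cyclic permutation even over the quaternions, hence the
  real trace of \<open>E\<close> is that of \<open>P P^* = 1\<close>, namely \<open>k\<close>.  The squared Frobenius distance of \<open>E\<close> from
  the identity is therefore \<open>k - 2 k + k = 0\<close>.\<close>

lemma Sp_imp_stiefel:
  assumes "P \<in> Sp k"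
  shows "P \<in> stiefel k k"
proof -
  define E where "E = qadjoint P * P"
  have P: "P \<in> carrier_mat k k" "qadjoint P \<in> carrier_mat k k" "P * qadjoint P = 1\<^sub>m k"
    using assms by (auto simp: Sp_def)
  have E: "E \<in> carrier_mat k k" unfolding E_def by (rule mult_carrier_mat [OF P(2,1)])
  have "P * E = P * qadjoint P * P"
    unfolding E_def by (rule assoc_mult_mat [OF P(1,2,1), symmetric])
  then have "P * E = P" using P by simp
  moreover have "E * E = qadjoint P * (P * E)"
    by (subst (1) E_def) (rule assoc_mult_mat [OF P(2,1) E])
  ultimately have EE: "E * E = E" by (simp add: E_def)
  have e: "E $$ (j, l) = hip {..<k} (column_family P j) (column_family P l)" if "j < k" "l < k" for j l
    using P that by (simp add: E_def qadjoint_mult_entry)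
  have herm: "E $$ (l, j) = qcnj (E $$ (j, l))" if "j < k" "l < k" for j l
    using that by (simp add: e hip_commute)
  have row: "(\<Sum>l<k. (norm (E $$ (j, l)))\<^sup>2) = qRe (E $$ (j, j))" if "j < k" for j
  proof -
    have "E $$ (j, j) = (E * E) $$ (j, j)" by (simp add: EE)
    also have "\<dots> = (\<Sum>l<k. E $$ (j, l) * E $$ (l, j))"
      using E that by (auto simp: scalar_prod_def atLeast0LessThan intro!: sum.cong)
    also have "\<dots> = (\<Sum>l<k. of_real ((norm (E $$ (l, j)))\<^sup>2))"
      using that by (intro sum.cong refl) (metis herm lessThan_iff qcnj_mult_self)
    finally have "qRe (E $$ (j, j)) = (\<Sum>l<k. (norm (E $$ (l, j)))\<^sup>2)"
      by (simp add: qRe_sum del: of_real_power)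
    also have "\<dots> = (\<Sum>l<k. (norm (E $$ (j, l)))\<^sup>2)"
      using that by (intro sum.cong refl) (metis herm lessThan_iff norm_qcnj)
    finally show ?thesis by simp
  qed
  have trace: "(\<Sum>j<k. qRe (E $$ (j, j))) = real k"
  proof -
    have "(\<Sum>j<k. qRe (E $$ (j, j))) = (\<Sum>j<k. \<Sum>i<k. (norm (P $$ (i, j)))\<^sup>2)"
      by (simp add: e hip_self del: of_real_power of_real_sum)
    also have "\<dots> = (\<Sum>i<k. \<Sum>j<k. (norm (P $$ (i, j)))\<^sup>2)" by (rule sum.swap)
    also have "\<dots> = (\<Sum>i<k. qRe ((P * qadjoint P) $$ (i, i)))"
    proof (rule sum.cong [OF refl])
      fix i assume "i \<in> {..<k}"
      then have "(P * qadjoint P) $$ (i, i) = (\<Sum>j<k. P $$ (i, j) * qcnj (P $$ (i, j)))"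
        using P(1) by (auto simp: qadjoint_def scalar_prod_def atLeast0LessThan intro!: sum.cong)
      also have "\<dots> = (\<Sum>j<k. of_real ((norm (P $$ (i, j)))\<^sup>2))"
        by (intro sum.cong refl) (metis norm_qcnj qcnj_mult_self qcnj_qcnj)
      finally show "(\<Sum>j<k. (norm (P $$ (i, j)))\<^sup>2) = qRe ((P * qadjoint P) $$ (i, i))"
        by (simp add: qRe_sum del: of_real_power)
    qed
    finally show ?thesis by (simp add: P(3))
  qed
  have "(\<Sum>j<k. \<Sum>l<k. (norm (E $$ (j, l) - (if j = l then 1 else 0)))\<^sup>2) = 0"
  proof -
    have "(norm (E $$ (j, l) - (if j = l then 1 else 0)))\<^sup>2 =
        (norm (E $$ (j, l)))\<^sup>2 + (if j = l then 1 - 2 * qRe (E $$ (j, l)) else 0)" for j l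
      by (simp add: norm_quat_sq) (simp add: power2_eq_square algebra_simps)
    then have "(\<Sum>j<k. \<Sum>l<k. (norm (E $$ (j, l) - (if j = l then 1 else 0)))\<^sup>2) =
        (\<Sum>j<k. qRe (E $$ (j, j)) + (1 - 2 * qRe (E $$ (j, j))))"
      by (simp add: sum.distrib row)
    also have "\<dots> = 0"
      using trace by (simp add: sum.distrib sum_subtractf flip: sum_distrib_left)
    finally show ?thesis .
  qed
  then have "E $$ (j, l) - (if j = l then 1 else 0) = 0" if "j < k" "l < k" for j l
    using that by (simp add: sum_nonneg_eq_0_iff sum_nonneg del: right_minus_eq)
  then show ?thesis
    using P e by (simp add: stiefel_iff_orthonormal orthonormal_def)
qed


section \<open>Deforming a frame to a constant one\<close>

text \<open>If the coefficients \<open>a\<close> annihilate the lower rows, then \<open>y = x a\<close> lives in the first \<open>m\<close> rows.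
  Since \<open>x\<close> is an isometry, \<open>|a| = |y| = |T a|\<close>, which is at most the Frobenius norm of the upper
  block \<open>T\<close> times \<open>|a|\<close>.  As that norm is less than \<open>1\<close>, it follows that \<open>a = 0\<close>.\<close>

lemma frame_lower_rows:
  assumes x: "x \<in> stiefel n k" and "m \<le> n"
    and small: "(\<Sum>i<m. \<Sum>j<k. (norm (x $$ (i, j)))\<^sup>2) < 1"
  shows "frame {m..<n} k (column_family x)"
  unfolding frame_def
proof (intro allI impI)
  fix a j assume a: "\<forall>i\<in>{m..<n}. (\<Sum>j<k. x $$ (i, j) * a j) = 0" and j: "j < k"
  define y where "y i = (\<Sum>j<k. x $$ (i, j) * a j)" for i
  define N where "N = (\<Sum>j<k. (norm (a j))\<^sup>2)"
  have ortho: "orthonormal {..<n} k (column_family x)"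
    using x by (simp add: stiefel_iff_orthonormal)
  have coef: "hip {..<n} (column_family x j) y = a j" if "j < k" for j
  proof -
    have "hip {..<n} (column_family x j) y = (\<Sum>l<k. hip {..<n} (column_family x j) (column_family x l) * a l)"
      unfolding y_def by (simp add: hip_sum_right hip_mult_right)
    also have "\<dots> = (\<Sum>l<k. if j = l then a l else 0)"
      using ortho that by (intro sum.cong) (auto simp: orthonormal_def)
    finally show ?thesis using that by simp
  qed
  have "hip {..<n} y y = (\<Sum>j<k. hip {..<n} y (column_family x j) * a j)"
    unfolding y_def by (simp add: hip_sum_right hip_mult_right)
  also have "\<dots> = (\<Sum>j<k. qcnj (a j) * a j)"
    by (intro sum.cong refl) (simp add: coef flip: hip_commute [of _ "column_family x _" y])
  finally have "(of_real (\<Sum>i<n. (norm (y i))\<^sup>2) :: quat) = of_real N"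
    by (simp add: hip_self N_def qcnj_mult_self)
  then have "N = (\<Sum>i<n. (norm (y i))\<^sup>2)" unfolding of_real_eq_iff by simp
  also have "\<dots> = (\<Sum>i<m. (norm (y i))\<^sup>2)"
    using a \<open>m \<le> n\<close> by (intro sum.mono_neutral_right) (auto simp: y_def)
  also have "\<dots> \<le> (\<Sum>i<m. (\<Sum>j<k. (norm (x $$ (i, j)))\<^sup>2) * N)"
  proof (rule sum_mono)
    fix i
    have "norm (y i) \<le> (\<Sum>j<k. norm (x $$ (i, j)) * norm (a j))"
      unfolding y_def by (rule order_trans [OF norm_sum]) (simp add: norm_mult)
    then have "(norm (y i))\<^sup>2 \<le> (\<Sum>j<k. norm (x $$ (i, j)) * norm (a j))\<^sup>2"
      by (intro power_mono) auto
    also have "\<dots> \<le> (\<Sum>j<k. (norm (x $$ (i, j)))\<^sup>2) * N"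
      unfolding N_def by (rule Cauchy_Schwarz_ineq_sum)
    finally show "(norm (y i))\<^sup>2 \<le> (\<Sum>j<k. (norm (x $$ (i, j)))\<^sup>2) * N" .
  qed
  finally have "N \<le> (\<Sum>i<m. \<Sum>j<k. (norm (x $$ (i, j)))\<^sup>2) * N"
    by (simp add: sum_distrib_right)
  moreover have "N \<ge> 0" by (simp add: N_def sum_nonneg)
  ultimately have "N = 0"
    using small mult_strict_right_mono [of "\<Sum>i<m. \<Sum>j<k. (norm (x $$ (i, j)))\<^sup>2" 1 N] by fastforce
  then show "a j = 0" using j by (simp add: N_def sum_nonneg_eq_0_iff)
qed

definition independent_pair :: "'i set \<Rightarrow> ('i \<Rightarrow> quat) \<Rightarrow> ('i \<Rightarrow> quat) \<Rightarrow> bool" where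
  "independent_pair I u v \<longleftrightarrow> (\<forall>a b. (\<forall>i\<in>I. u i * a + v i * b = 0) \<longrightarrow> a = 0 \<and> b = 0)"

text \<open>The matrix \<open>[I, 0, 0; 0, u, v]\<close> with upper left identity block of size \<open>m\<close>; the entries of \<open>u\<close>
  and \<open>v\<close> in the first \<open>m\<close> rows are discarded.\<close>

definition block_frame :: "nat \<Rightarrow> (nat \<Rightarrow> quat) \<Rightarrow> (nat \<Rightarrow> quat) \<Rightarrow> nat \<Rightarrow> nat \<Rightarrow> quat" where
  "block_frame m u v j i =
     (if j < m then if i = j then 1 else 0
      else if i < m then 0 else if j = m then u i else v i)"

lemma frame_block_frame:
  assumes "m \<le> n" "independent_pair {m..<n} u v"
  shows "frame {..<n} (Suc (Suc m)) (block_frame m u v)"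
  unfolding frame_def
proof (intro allI impI)
  fix a j assume a: "\<forall>i\<in>{..<n}. (\<Sum>j<Suc (Suc m). block_frame m u v j i * a j) = 0"
    and j: "j < Suc (Suc m)"
  have top: "a i = 0" if "i < m" for i
  proof -
    have "(\<Sum>j<m. block_frame m u v j i * a j) = (\<Sum>j<m. if i = j then a j else 0)"
      by (intro sum.cong) (auto simp: block_frame_def)
    moreover have "block_frame m u v m i = 0" "block_frame m u v (Suc m) i = 0"
      using that by (simp_all add: block_frame_def)
    ultimately have "(\<Sum>j<Suc (Suc m). block_frame m u v j i * a j) = a i"
      using that by simp
    moreover have "i \<in> {..<n}" using that assms(1) by simp
    ultimately show ?thesis using bspec [OF a, of i] by (simp only:)
  qed
  have "u i * a m + v i * a (Suc m) = 0" if "i \<in> {m..<n}" for i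
  proof -
    have "(\<Sum>j<m. block_frame m u v j i * a j) = 0" by (simp add: top)
    moreover have "block_frame m u v m i = u i" "block_frame m u v (Suc m) i = v i"
      using that by (simp_all add: block_frame_def)
    moreover have "i \<in> {..<n}" using that by simp
    ultimately show ?thesis using bspec [OF a, of i] by simp
  qed
  then have "a m = 0 \<and> a (Suc m) = 0"
    using assms(2) unfolding independent_pair_def by blast
  then show "a j = 0" using top j by (auto simp: less_Suc_eq)
qed

lemma block_frame_segment:
  "(1 - t) *\<^sub>R block_frame m u v j i + t *\<^sub>R block_frame m u' v' j i =
   block_frame m (\<lambda>i. (1 - t) *\<^sub>R u i + t *\<^sub>R u' i) (\<lambda>i. (1 - t) *\<^sub>R v i + t *\<^sub>R v' i) j i"
  by (simp add: block_frame_def flip: scaleR_left.add)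

lemma continuous_map_block_frame:
  assumes "\<And>i. i \<in> {m..<n} \<Longrightarrow> continuous_map Z euclidean (\<lambda>z. u z i)"
    and "\<And>i. i \<in> {m..<n} \<Longrightarrow> continuous_map Z euclidean (\<lambda>z. v z i)"
    and "i < n"
  shows "continuous_map Z euclidean (\<lambda>z. block_frame m (u z) (v z) j i)"
  using assms by (auto simp: block_frame_def)

definition signed_axis :: "nat \<Rightarrow> real \<Rightarrow> nat \<Rightarrow> quat" where
  "signed_axis l s i = (if i = l then of_real s else 0)"

text \<open>The functional \<open>w \<mapsto> \<langle>u + s e, w\<rangle>\<close>, where \<open>e\<close> is the unit vector of row \<open>l\<close>.  For a unit vector
  \<open>u\<close> and \<open>s = 1\<close> or \<open>s = - 1\<close>, its values at \<open>u\<close> and at \<open>s e\<close> are \<open>1 + s u_l\<close> and the conjugate of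
  that number.  Both have positive real part as soon as the real part of \<open>u_l\<close> is not \<open>- s\<close>, and
  then so has its value at every point of the segment between \<open>u\<close> and \<open>s e\<close>.\<close>

definition pivot_form :: "nat set \<Rightarrow> nat \<Rightarrow> real \<Rightarrow> (nat \<Rightarrow> quat) \<Rightarrow> (nat \<Rightarrow> quat) \<Rightarrow> quat" where
  "pivot_form I l s u w = hip I u w + s *\<^sub>R w l"

text \<open>The projection of \<open>v\<close> along \<open>u\<close> onto the kernel of \<open>pivot_form\<close>.\<close>

definition shear :: "nat set \<Rightarrow> nat \<Rightarrow> real \<Rightarrow> (nat \<Rightarrow> quat) \<Rightarrow> (nat \<Rightarrow> quat) \<Rightarrow> nat \<Rightarrow> quat" where
  "shear I l s u v i = v i - u i * (inverse (pivot_form I l s u u) * pivot_form I l s u v)"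

lemma pivot_form_linear:
  "pivot_form I l s u (\<lambda>i. v i * a + w i * b) = pivot_form I l s u v * a + pivot_form I l s u w * b"
  "pivot_form I l s u (\<lambda>i. p *\<^sub>R v i + r *\<^sub>R w i) = p *\<^sub>R pivot_form I l s u v + r *\<^sub>R pivot_form I l s u w"
  "pivot_form I l s u (\<lambda>i. v i - w i * b) = pivot_form I l s u v - pivot_form I l s u w * b"
  by (simp_all add: pivot_form_def hip_add_right hip_diff_right hip_mult_right hip_scaleR_right
      algebra_simps)

lemma pivot_form_cong:
  assumes "\<And>i. i \<in> I \<Longrightarrow> v i = w i" "l \<in> I"
  shows "pivot_form I l s u v = pivot_form I l s u w"
  using assms by (simp add: pivot_form_def hip_def)

lemma pivot_form_supported:
  assumes "finite I" "l \<in> I" "\<And>i. i \<in> I \<Longrightarrow> i \<noteq> l \<Longrightarrow> w i = 0"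
  shows "pivot_form I l s u w = (qcnj (u l) + of_real s) * w l"
proof -
  have "hip I u w = (\<Sum>i\<in>I. if i = l then qcnj (u i) * w i else 0)"
    unfolding hip_def using assms(3) by (intro sum.cong) auto
  then show ?thesis
    using assms by (simp add: pivot_form_def distrib_right scaleR_conv_of_real)
qed

lemma pivot_form_shear:
  assumes "pivot_form I l s u u \<noteq> 0"
  shows "pivot_form I l s u (shear I l s u v) = 0"
  unfolding shear_def [abs_def] pivot_form_linear(3) using assms by (simp flip: mult.assoc)

text \<open>Otherwise \<open>X (Suc m)\<close> would be a right multiple of \<open>X m\<close>.\<close>

lemma shear_nonzero:
  assumes "frame I (Suc (Suc m)) X"
  shows "\<exists>i\<in>I. shear I l s (X m) (X (Suc m)) i \<noteq> 0"
proof (rule ccontr)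
  assume "\<not> ?thesis"
  then obtain c where c: "\<forall>i\<in>I. X (Suc m) i - X m i * c = 0" by (auto simp: shear_def)
  define a where "a j = (if j = m then - c else if j = Suc m then 1 else 0)" for j
  have "(\<Sum>j<m. X j i * a j) = 0" for i by (simp add: a_def)
  then have "\<forall>i\<in>I. (\<Sum>j<Suc (Suc m). X j i * a j) = 0"
    using c by (simp add: a_def)
  then have "a (Suc m) = 0" using assms unfolding frame_def by blast
  then show False by (simp add: a_def)
qed

text \<open>One segment replaces the first \<open>m\<close> columns by unit vectors and shears the last column along the
  one before it.  At time \<open>r\<close>, let \<open>a\<close> be a relation between the columns.  The upper rows give
  \<open>r a_j = 0\<close> for \<open>j < m\<close>.  On the lower rows the relation reads \<open>P b = 0\<close>, where \<open>b\<close> has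
  coefficients \<open>(1 - r) a_j\<close> for \<open>j < m\<close> and differs from \<open>a\<close> in the last two places only by an
  invertible column operation; so \<open>b = 0\<close>, and \<open>a_j = r a_j + (1 - r) a_j = 0\<close>.\<close>

lemma frame_shear_segment:
  assumes fr: "frame {m..<n} (Suc (Suc m)) (column_family x)" and "m \<le> n"
  shows "frame {..<n} (Suc (Suc m)) (\<lambda>j i. (1 - r) *\<^sub>R (if i < m then 0 else x $$ (i, j)) +
    r *\<^sub>R block_frame m (column_family x m) (shear I l s (column_family x m) (column_family x (Suc m))) j i)"
    (is "frame _ _ ?X")
  unfolding frame_def
proof (intro allI impI)
  fix a j assume a: "\<forall>i\<in>{..<n}. (\<Sum>j<Suc (Suc m). ?X j i * a j) = 0"
    and j: "j < Suc (Suc m)"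
  have top: "r *\<^sub>R a i = 0" if "i < m" for i
  proof -
    have "(\<Sum>j<m. ?X j i * a j) = (\<Sum>j<m. if i = j then r *\<^sub>R a j else 0)"
      using that by (intro sum.cong) (auto simp: block_frame_def)
    also have "\<dots> = r *\<^sub>R a i" using that by simp
    moreover have "?X m i * a m = 0" "?X (Suc m) i * a (Suc m) = 0"
      using that by (simp_all add: block_frame_def)
    ultimately have "(\<Sum>j<Suc (Suc m). ?X j i * a j) = r *\<^sub>R a i"
      by (simp only: sum.lessThan_Suc add_0_right)
    moreover have "i \<in> {..<n}" using that assms(2) by simp
    ultimately show ?thesis using bspec [OF a, of i] by (simp only:)
  qed
  define c where "c = inverse (pivot_form I l s (column_family x m) (column_family x m)) *
    pivot_form I l s (column_family x m) (column_family x (Suc m))"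
  define b where "b j = (if j < m then (1 - r) *\<^sub>R a j
    else if j = m then a m - r *\<^sub>R (c * a (Suc m)) else a j)" for j
  have "(\<Sum>j<Suc (Suc m). x $$ (i, j) * b j) = 0" if i: "i \<in> {m..<n}" for i
  proof -
    have "(\<Sum>j<m. ?X j i * a j) = (\<Sum>j<m. x $$ (i, j) * b j)"
      using i by (intro sum.cong) (auto simp: block_frame_def b_def)
    moreover have "?X m i * a m + ?X (Suc m) i * a (Suc m) =
        x $$ (i, m) * b m + x $$ (i, Suc m) * b (Suc m)"
      using i by (simp add: block_frame_def b_def shear_def c_def algebra_simps)
    ultimately have "(\<Sum>j<Suc (Suc m). x $$ (i, j) * b j) = (\<Sum>j<Suc (Suc m). ?X j i * a j)"
      by (simp add: add.assoc)
    moreover have "i \<in> {..<n}" using i by simp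
    ultimately show ?thesis using bspec [OF a, of i] by (simp only:)
  qed
  then have b: "b j = 0" if "j < Suc (Suc m)" for j
    using fr that unfolding frame_def by blast
  have "a (Suc m) = 0" using b [of "Suc m"] by (simp add: b_def)
  moreover have "a m = 0" using b [of m] calculation by (simp add: b_def)
  moreover have "a i = 0" if "i < m" for i
    using top [OF that] b [of i] that by (auto simp: b_def)
  ultimately show "a j = 0" using j by (auto simp: less_Suc_eq)
qed

text \<open>Applying the functional to a relation between \<open>w\<close> and \<open>v\<close> kills the coefficient of \<open>w\<close>.\<close>

lemma independent_pair_kernel:
  assumes I: "l \<in> I" and "pivot_form I l s u w \<noteq> 0" "pivot_form I l s u v = 0" "\<exists>i\<in>I. v i \<noteq> 0"
  shows "independent_pair I w v"
  unfolding independent_pair_def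
proof (intro allI impI)
  fix a b assume ab: "\<forall>i\<in>I. w i * a + v i * b = 0"
  have "pivot_form I l s u (\<lambda>i. w i * a + v i * b) = pivot_form I l s u (\<lambda>i. 0)"
    using ab by (intro pivot_form_cong I) auto
  then have "a = 0" using assms by (simp add: pivot_form_linear) (simp add: pivot_form_def hip_def)
  then show "a = 0 \<and> b = 0" using ab assms(4) by auto
qed

lemma independent_pair_signed_axis:
  assumes "l \<in> I" "s \<noteq> 0" "\<exists>i\<in>I. i \<noteq> l \<and> v i \<noteq> 0"
  shows "independent_pair I (signed_axis l s) v"
  unfolding independent_pair_def
proof (intro allI impI)
  fix a b assume ab: "\<forall>i\<in>I. signed_axis l s i * a + v i * b = 0"
  then have "b = 0" using assms(3) by (auto simp: signed_axis_def)
  then show "a = 0 \<and> b = 0" using ab assms(1,2) by (auto simp: signed_axis_def)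
qed

text \<open>The positivity condition says that \<open>w\<close> is not a multiple of the target by a real number
  \<open>\<le> 0\<close>, which is exactly what keeps the segment away from \<open>0\<close>.  A sum of norms is used because it
  makes the condition a strict inequality between continuous functions, hence open, and because the
  two expressions for \<open>t = 1\<close> and \<open>t = - 1\<close> add up to a positive number whenever \<open>w\<close> is nonzero
  somewhere on \<open>J\<close>.\<close>

lemma segment_to_signed_axis_nonzero:
  assumes t: "\<bar>t\<bar> = 1" and r: "0 \<le> r" "r \<le> 1" and "finite J" "l \<in> J"
    and pos: "0 < t * qRe (w l) + (\<Sum>i\<in>J. norm (w i))"
  shows "\<exists>i\<in>J. (1 - r) *\<^sub>R w i + r *\<^sub>R signed_axis l t i \<noteq> 0"
proof (rule ccontr)
  assume "\<not> ?thesis"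
  then have z: "(1 - r) *\<^sub>R w i + r *\<^sub>R signed_axis l t i = 0" if "i \<in> J" for i
    using that by blast
  have "r \<noteq> 1" using z [OF \<open>l \<in> J\<close>] t by (auto simp: signed_axis_def)
  have "w i = 0" if "i \<in> J - {l}" for i
    using z [of i] that \<open>r \<noteq> 1\<close> by (auto simp: signed_axis_def)
  then have only_l: "(\<Sum>i\<in>J. norm (w i)) = norm (w l)"
    using assms by (simp add: sum.remove [of J l])
  have "(1 - r) *\<^sub>R w l = - (r * t) *\<^sub>R 1"
    using z [OF \<open>l \<in> J\<close>] by (simp add: signed_axis_def of_real_def eq_neg_iff_add_eq_0)
  then have "qRe ((1 - r) *\<^sub>R w l) = - (r * t)" "norm ((1 - r) *\<^sub>R w l) = r"
    using r t by (simp_all add: abs_mult del: scaleR_quat.simps) simp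
  then have "(1 - r) * qRe (w l) = - (r * t)" "(1 - r) * norm (w l) = r"
    using r by simp_all
  moreover have "(1 - r) * (t * qRe (w l) + norm (w l)) = t * ((1 - r) * qRe (w l)) + (1 - r) * norm (w l)"
    by (simp add: algebra_simps)
  ultimately have "(1 - r) * (t * qRe (w l) + norm (w l)) = r - r * (t * t)"
    by simp
  moreover have "t * t = 1" using t by (metis abs_mult_self_eq mult_1)
  ultimately have "(1 - r) * (t * qRe (w l) + (\<Sum>i\<in>J. norm (w i))) = 0"
    using only_l by simp
  then show False using pos \<open>r \<noteq> 1\<close> by simp
qed

section \<open>The four open sets\<close>

text \<open>The first condition makes the lower rows a frame.  The other two say that the functional
  \<open>pivot_form\<close> has positive real part at both ends of the segment from \<open>u\<close> to \<open>s e\<close>; they are stated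
  separately since the lower part \<open>u\<close> of a column need not have unit length off \<open>Sp(k)\<close>.\<close>

definition shear_domain :: "nat \<Rightarrow> nat \<Rightarrow> real \<Rightarrow> quat mat set" where
  "shear_domain n m s = {x \<in> stiefel n (Suc (Suc m)).
     (\<Sum>i<m. \<Sum>j<Suc (Suc m). (norm (x $$ (i, j)))\<^sup>2) < 1 \<and>
     0 < qRe (pivot_form {m..<n} m s (column_family x m) (column_family x m)) \<and>
     0 < 1 + s * qRe (x $$ (m, m))}"

definition cleared_vector :: "nat \<Rightarrow> nat \<Rightarrow> real \<Rightarrow> quat mat \<Rightarrow> nat \<Rightarrow> quat" where
  "cleared_vector n m s x = shear {m..<n} m s (column_family x m) (column_family x (Suc m))"

text \<open>The sum starts at row \<open>Suc m\<close>: when \<open>u\<close> has been moved to \<open>s e\<close>, only the part of the other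
  vector outside row \<open>m\<close> matters for independence.\<close>

definition categorical_set :: "nat \<Rightarrow> nat \<Rightarrow> real \<Rightarrow> real \<Rightarrow> quat mat set" where
  "categorical_set n m s t = {x \<in> shear_domain n m s.
     0 < t * qRe (cleared_vector n m s x (Suc m)) + (\<Sum>i\<in>{Suc m..<n}. norm (cleared_vector n m s x i))}"

lemma openin_positive:
  assumes "continuous_map X euclideanreal f"
  shows "openin X {x \<in> topspace X. 0 < f x}"
  using openin_continuous_map_preimage [OF assms, of "{0<..}"] by simp

lemma tendsto_entry:
  assumes "x \<in> S" "S \<subseteq> stiefel n k" "i < n" "j < k"
  shows "((\<lambda>x. x $$ (i, j)) \<longlongrightarrow> x $$ (i, j)) (atin (subtopology (stiefel_space n k) S) x)"
  using continuous_map_from_subtopology [OF continuous_map_entry [OF assms(3,4)], of S] assms(1,2)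
  by (auto simp: continuous_map_euclidean_iff_tendsto)

lemma openin_shear_domain:
  assumes "Suc m < n"
  shows "openin (stiefel_space n (Suc (Suc m))) (shear_domain n m s)"
proof -
  let ?X = "stiefel_space n (Suc (Suc m))"
  have entry: "((\<lambda>x. x $$ (i, j)) \<longlongrightarrow> x $$ (i, j)) (atin ?X x)"
    if "x \<in> stiefel n (Suc (Suc m))" "i < n" "j < Suc (Suc m)" for x i j
    using tendsto_entry [OF that(1) subset_refl that(2,3)] by (simp add: subtopology_topspace [of ?X, simplified])
  have "openin ?X {x \<in> topspace ?X. 0 < 1 - (\<Sum>i<m. \<Sum>j<Suc (Suc m). (norm (x $$ (i, j)))\<^sup>2)}"
    using assms
    by (intro openin_positive) (auto simp: continuous_map_euclidean_iff_tendsto simp del: sum.lessThan_Suc intro!: tendsto_intros entry)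
  moreover have "openin ?X {x \<in> topspace ?X. 0 < qRe (pivot_form {m..<n} m s (column_family x m) (column_family x m))}"
    using assms
    by (intro openin_positive) (auto simp: continuous_map_euclidean_iff_tendsto pivot_form_def intro!: tendsto_intros tendsto_hip entry)
  moreover have "openin ?X {x \<in> topspace ?X. 0 < 1 + s * qRe (x $$ (m, m))}"
    using assms
    by (intro openin_positive) (auto simp: continuous_map_euclidean_iff_tendsto intro!: tendsto_intros entry)
  ultimately have "openin ?X
    ({x \<in> topspace ?X. 0 < 1 - (\<Sum>i<m. \<Sum>j<Suc (Suc m). (norm (x $$ (i, j)))\<^sup>2)} \<inter>
     {x \<in> topspace ?X. 0 < qRe (pivot_form {m..<n} m s (column_family x m) (column_family x m))} \<inter>
     {x \<in> topspace ?X. 0 < 1 + s * qRe (x $$ (m, m))})"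
    by (intro openin_Int)
  then show ?thesis
    by (rule back_subst [of "openin ?X"]) (auto simp: shear_domain_def)
qed

lemma shear_domain_pivot:
  assumes "x \<in> shear_domain n m s"
  shows "pivot_form {m..<n} m s (column_family x m) (column_family x m) \<noteq> 0"
  using assms by (auto simp: shear_domain_def)

lemma continuous_cleared_vector:
  assumes "Suc m < n" "S \<subseteq> shear_domain n m s" "i \<in> {m..<n}"
  shows "continuous_map (subtopology (stiefel_space n (Suc (Suc m))) S) euclidean
    (\<lambda>x. cleared_vector n m s x i)"
proof -
  have S: "S \<subseteq> stiefel n (Suc (Suc m))" using assms(2) by (auto simp: shear_domain_def)
  have "((\<lambda>x. cleared_vector n m s x i) \<longlongrightarrow> cleared_vector n m s x i)
      (atin (subtopology (stiefel_space n (Suc (Suc m))) S) x)" if "x \<in> S" for x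
    unfolding cleared_vector_def shear_def using that assms shear_domain_pivot [of x n m s]
    by (auto simp: pivot_form_def intro!: tendsto_intros tendsto_hip tendsto_entry [OF that S])
  then show ?thesis using S by (simp add: continuous_map_euclidean_iff_tendsto Int_absorb2)
qed

lemma openin_categorical_set:
  assumes "Suc m < n"
  shows "openin (stiefel_space n (Suc (Suc m))) (categorical_set n m s t)"
proof -
  let ?X = "stiefel_space n (Suc (Suc m))"
  let ?D = "shear_domain n m s"
  have D: "topspace (subtopology ?X ?D) = ?D" by (auto simp: shear_domain_def)
  have sv: "((\<lambda>x. cleared_vector n m s x i) \<longlongrightarrow> cleared_vector n m s x i) (atin (subtopology ?X ?D) x)"
    if "x \<in> ?D" "i \<in> {m..<n}" for x i
    using continuous_cleared_vector [OF assms subset_refl that(2), of s] that(1)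
    unfolding continuous_map_euclidean_iff_tendsto D by blast
  have "openin (subtopology ?X ?D) {x \<in> topspace (subtopology ?X ?D).
      0 < t * qRe (cleared_vector n m s x (Suc m)) + (\<Sum>i\<in>{Suc m..<n}. norm (cleared_vector n m s x i))}"
    using assms
    by (intro openin_positive, unfold continuous_map_euclidean_iff_tendsto D, intro ballI tendsto_intros sv) auto
  then show ?thesis
    unfolding D categorical_set_def [symmetric]
    using openin_shear_domain [OF assms] openin_trans_full by blast
qed

text \<open>Four segments are concatenated.  The first, from \<open>[T; P]\<close> to \<open>[0; P]\<close>, runs through frames
  because the lower rows stay fixed; the second ends in the block frame of \<open>u\<close> and the sheared vector.
  The third moves \<open>u\<close> to \<open>s e\<close> and needs the sheared vector in the kernel of the functional; the
  fourth moves that vector to \<open>t f\<close>, which can be done independently of \<open>u\<close> only now that \<open>s e\<close> is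
  supported in a single row.\<close>

lemma contractible_categorical_set:
  assumes mn: "Suc m < n" and s: "\<bar>s\<bar> = 1" and t: "\<bar>t\<bar> = 1"
  shows "contractible_in (stiefel_space n (Suc (Suc m))) (categorical_set n m s t)"
proof -
  let ?k = "Suc (Suc m)"
  let ?X = "stiefel_space n ?k"
  let ?U = "categorical_set n m s t"
  let ?Z = "subtopology ?X ?U"
  let ?I = "{m..<n}"
  let ?v = "cleared_vector n m s"
  have UD: "?U \<subseteq> shear_domain n m s" by (auto simp: categorical_set_def)
  then have US: "?U \<subseteq> stiefel n ?k" by (auto simp: shear_domain_def)
  then have Z: "topspace ?Z = ?U" by auto
  have entry: "continuous_map ?Z euclidean (\<lambda>x. x $$ (i, j))" if "i < n" "j < ?k" for i j
    using continuous_map_entry [OF that] by (rule continuous_map_from_subtopology)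
  have sv: "continuous_map ?Z euclidean (\<lambda>x. ?v x i)" if "i \<in> ?I" for i
    using continuous_cleared_vector [OF mn UD that] .
  have lower: "frame ?I ?k (column_family x)" if "x \<in> ?U" for x
    using that UD mn by (intro frame_lower_rows) (auto simp: shear_domain_def)
  have ker: "pivot_form ?I m s (column_family x m) (?v x) = 0" if "x \<in> ?U" for x
    unfolding cleared_vector_def using that UD by (intro pivot_form_shear shear_domain_pivot) auto
  have nz: "\<exists>i\<in>?I. ?v x i \<noteq> 0" if "x \<in> ?U" for x
    using shear_nonzero [OF lower [OF that]] by (simp add: cleared_vector_def)
  define F1 where "F1 x j i = (if i < m then 0 else x $$ (i, j))" for x :: "quat mat" and j i
  define F2 where "F2 x = block_frame m (column_family x m) (?v x)" for x
  define F3 where "F3 x = block_frame m (signed_axis m s) (?v x)" for x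
  define F4 where "F4 x = block_frame m (signed_axis m s) (signed_axis (Suc m) t)" for x :: "quat mat"
  have c1: "continuous_map ?Z euclidean (\<lambda>x. F1 x j i)" if "i < n" "j < ?k" for i j
    using entry [OF that] by (simp add: F1_def)
  have c2: "continuous_map ?Z euclidean (\<lambda>x. F2 x j i)" if "i < n" for i j
    unfolding F2_def using sv entry that by (intro continuous_map_block_frame) auto
  have c3: "continuous_map ?Z euclidean (\<lambda>x. F3 x j i)" if "i < n" for i j
    unfolding F3_def using sv that by (intro continuous_map_block_frame) auto
  have c4: "continuous_map ?Z euclidean (\<lambda>x. F4 x j i)" for i j
    by (simp add: F4_def)
  let ?H = "\<lambda>F G. homotopic_with (\<lambda>_. True) ?Z ?X (\<lambda>x. orthonormalize n ?k (F x)) (\<lambda>x. orthonormalize n ?k (G x))"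
  have "?H column_family F1"
  proof (rule homotopic_orthonormalize [OF entry c1])
    fix x r assume x: "x \<in> topspace ?Z"
    have "frame ?I ?k (column_family x)" using lower x Z by blast
    then show "frame {..<n} ?k (\<lambda>j i. (1 - r) *\<^sub>R x $$ (i, j) + r *\<^sub>R F1 x j i)"
      unfolding frame_def F1_def by (auto simp flip: scaleR_left.add)
  qed
  moreover have "?H F1 F2"
  proof (rule homotopic_orthonormalize [OF c1 c2])
    fix x r assume x: "x \<in> topspace ?Z"
    have "frame ?I ?k (column_family x)" using lower x Z by blast
    from frame_shear_segment [OF this] mn
    show "frame {..<n} ?k (\<lambda>j i. (1 - r) *\<^sub>R F1 x j i + r *\<^sub>R F2 x j i)"
      by (simp add: F1_def F2_def cleared_vector_def)
  qed
  moreover have "?H F2 F3"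
  proof (rule homotopic_orthonormalize [OF c2 c3])
    fix x r assume x: "x \<in> topspace ?Z" and r: "0 \<le> r" "r \<le> (1 :: real)"
    then have xU: "x \<in> ?U" using Z by blast
    let ?f = "pivot_form ?I m s (column_family x m)"
    (* The functional has positive real part at both ends, hence on the whole segment. *)
    have "?f (signed_axis m s) = (qcnj (x $$ (m, m)) + of_real s) * of_real s"
      using mn by (subst pivot_form_supported) (auto simp: signed_axis_def)
    moreover have "s * s = 1" using s by (metis abs_mult_self_eq mult_1)
    ultimately have "qRe (?f (signed_axis m s)) = 1 + s * qRe (x $$ (m, m))"
      by (simp add: of_real_def algebra_simps)
    then have "0 < qRe (?f (signed_axis m s))" "0 < qRe (?f (column_family x m))"
      using xU UD by (auto simp: shear_domain_def)
    then have "0 < (1 - r) * qRe (?f (column_family x m)) + r * qRe (?f (signed_axis m s))"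
      using r by (smt (verit) mult_nonneg_nonneg mult_pos_pos)
    then have "?f (\<lambda>i. (1 - r) *\<^sub>R column_family x m i + r *\<^sub>R signed_axis m s i) \<noteq> 0"
      by (auto simp: pivot_form_linear quat_eq_iff)
    then have "independent_pair ?I (\<lambda>i. (1 - r) *\<^sub>R column_family x m i + r *\<^sub>R signed_axis m s i) (?v x)"
      using ker [OF xU] nz [OF xU] mn by (intro independent_pair_kernel) auto
    with mn show "frame {..<n} ?k (\<lambda>j i. (1 - r) *\<^sub>R F2 x j i + r *\<^sub>R F3 x j i)"
      unfolding F2_def F3_def block_frame_segment
      by (intro frame_block_frame) (simp_all flip: scaleR_left.add)
  qed
  moreover have "?H F3 F4"
  proof (rule homotopic_orthonormalize [OF c3 c4])
    fix x r assume x: "x \<in> topspace ?Z" and r: "0 \<le> r" "r \<le> (1 :: real)"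
    then have "0 < t * qRe (?v x (Suc m)) + (\<Sum>i\<in>{Suc m..<n}. norm (?v x i))"
      using Z by (simp add: categorical_set_def)
    then have "\<exists>i\<in>{Suc m..<n}. (1 - r) *\<^sub>R ?v x i + r *\<^sub>R signed_axis (Suc m) t i \<noteq> 0"
      using r t mn by (intro segment_to_signed_axis_nonzero) auto
    then have "\<exists>i\<in>?I. i \<noteq> m \<and> (1 - r) *\<^sub>R ?v x i + r *\<^sub>R signed_axis (Suc m) t i \<noteq> 0" by force
    then have "independent_pair ?I (signed_axis m s) (\<lambda>i. (1 - r) *\<^sub>R ?v x i + r *\<^sub>R signed_axis (Suc m) t i)"
      using mn s by (intro independent_pair_signed_axis) auto
    with mn show "frame {..<n} ?k (\<lambda>j i. (1 - r) *\<^sub>R F3 x j i + r *\<^sub>R F4 x j i)"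
      unfolding F3_def F4_def block_frame_segment
      by (intro frame_block_frame) (simp_all flip: scaleR_left.add)
  qed
  ultimately have "?H column_family F4" by (meson homotopic_with_trans)
  then have "homotopic_with (\<lambda>_. True) ?Z ?X (\<lambda>x. x)
      (\<lambda>_. orthonormalize n ?k (block_frame m (signed_axis m s) (signed_axis (Suc m) t)))"
    by (rule homotopic_with_eq) (use US Z in \<open>auto simp: orthonormalize_columns F4_def\<close>)
  then show ?thesis unfolding contractible_in_def by blast
qed

text \<open>The sign \<open>s\<close> is chosen as that of the real part of \<open>u_m\<close>.  The sheared vector \<open>w\<close> then has a
  nonzero entry below row \<open>m\<close>: otherwise \<open>w\<close> is supported in row \<open>m\<close>, where the functional is
  multiplication by a quaternion with nonzero real part, and being in the kernel forces \<open>w = 0\<close>.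
  Finally \<open>t\<close> is chosen as the sign of the real part of the entry of \<open>w\<close> in row \<open>m + 1\<close>.\<close>

lemma categorical_sets_cover:
  assumes mn: "Suc m < n" and x: "x \<in> stiefel n (Suc (Suc m))"
    and zero: "\<And>i j. i < m \<Longrightarrow> j < Suc (Suc m) \<Longrightarrow> x $$ (i, j) = 0"
  shows "\<exists>s\<in>{1, -1}. \<exists>t\<in>{1, -1}. x \<in> categorical_set n m s t"
proof -
  let ?I = "{m..<n}"
  define s :: real where "s = (if qRe (x $$ (m, m)) \<ge> 0 then 1 else - 1)"
  have s: "s \<in> {1, -1}" "s * qRe (x $$ (m, m)) \<ge> 0" by (auto simp: s_def)
  have small: "(\<Sum>i<m. \<Sum>j<Suc (Suc m). (norm (x $$ (i, j)))\<^sup>2) = 0"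
    using zero by (intro sum.neutral ballI) auto
  have "hip ?I (column_family x m) (column_family x m) = hip {..<n} (column_family x m) (column_family x m)"
    unfolding hip_def using zero mn by (intro sum.mono_neutral_left) auto
  then have "hip ?I (column_family x m) (column_family x m) = 1"
    using x by (simp add: stiefel_iff_orthonormal orthonormal_def)
  then have D: "x \<in> shear_domain n m s"
    using s small x by (auto simp: shear_domain_def pivot_form_def simp del: sum.lessThan_Suc)
  have "\<exists>i\<in>{Suc m..<n}. cleared_vector n m s x i \<noteq> 0"
  proof (rule ccontr)
    assume "\<not> ?thesis"
    then have z: "cleared_vector n m s x i = 0" if "i \<in> ?I" "i \<noteq> m" for i
      using that by auto
    have "(qcnj (x $$ (m, m)) + of_real s) * cleared_vector n m s x m =
        pivot_form ?I m s (column_family x m) (cleared_vector n m s x)"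
      using mn z by (subst pivot_form_supported) auto
    also have "\<dots> = 0"
      unfolding cleared_vector_def by (rule pivot_form_shear [OF shear_domain_pivot [OF D]])
    finally have "(qcnj (x $$ (m, m)) + of_real s) * cleared_vector n m s x m = 0" .
    moreover have "qRe (qcnj (x $$ (m, m)) + of_real s) \<noteq> 0" by (simp add: s_def)
    then have "qcnj (x $$ (m, m)) + of_real s \<noteq> 0" by (metis zero_quat.simps(1))
    ultimately have "cleared_vector n m s x m = 0" by simp
    moreover have "frame ?I (Suc (Suc m)) (column_family x)"
      using D mn by (intro frame_lower_rows) (auto simp: shear_domain_def)
    then have "\<exists>i\<in>?I. cleared_vector n m s x i \<noteq> 0"
      unfolding cleared_vector_def by (rule shear_nonzero)
    ultimately show False using z by metis
  qed
  then have pos: "0 < (\<Sum>i\<in>{Suc m..<n}. norm (cleared_vector n m s x i))"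
    by (auto simp: sum_nonneg order_less_le sum_nonneg_eq_0_iff)
  define t :: real where "t = (if qRe (cleared_vector n m s x (Suc m)) \<ge> 0 then 1 else - 1)"
  have "t \<in> {1, -1}" "t * qRe (cleared_vector n m s x (Suc m)) \<ge> 0" by (auto simp: t_def)
  then show ?thesis using s D pos unfolding categorical_set_def by fastforce
qed

lemma stiefel_incl_entry:
  assumes "P \<in> carrier_mat k k" "i < n" "j < k" "k \<le> n"
  shows "stiefel_incl n k P $$ (i, j) = (if i < n - k then 0 else P $$ (i - (n - k), j))"
  using assms by (auto simp: stiefel_incl_def append_rows_def)

lemma stiefel_incl_Sp:
  assumes P: "P \<in> Sp k" and "k \<le> n"
  shows "stiefel_incl n k P \<in> stiefel n k"
proof -
  have Pc: "P \<in> carrier_mat k k" and ortho: "orthonormal {..<k} k (column_family P)"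
    using Sp_imp_stiefel [OF P] by (simp_all add: stiefel_iff_orthonormal)
  let ?x = "stiefel_incl n k P"
  have "hip {..<n} (column_family ?x j) (column_family ?x l) = hip {..<k} (column_family P j) (column_family P l)"
    if "j < k" "l < k" for j l
  proof -
    have "hip {..<n} (column_family ?x j) (column_family ?x l) = hip {n - k..<n} (column_family ?x j) (column_family ?x l)"
      unfolding hip_def using that Pc \<open>k \<le> n\<close>
      by (intro sum.mono_neutral_right) (auto simp: stiefel_incl_entry)
    also have "\<dots> = hip {..<k} (column_family P j) (column_family P l)"
      unfolding hip_def using that Pc \<open>k \<le> n\<close>
      by (intro sum.reindex_bij_witness [where i = "\<lambda>i. i + (n - k)" and j = "\<lambda>i. i - (n - k)"])
        (auto simp: stiefel_incl_entry)
    finally show ?thesis .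
  qed
  moreover have "?x \<in> carrier_mat n k"
    using Pc \<open>k \<le> n\<close> carrier_append_rows [OF zero_carrier_mat Pc, of "n - k"] by (simp add: stiefel_incl_def)
  ultimately show ?thesis using ortho by (simp add: stiefel_iff_orthonormal orthonormal_def)
qed

theorem proposition5p3:
  fixes k n :: nat
  assumes "k > 1" and "n = 2 * k - 2"
  shows "subspace_cat (stiefel_space n k) (stiefel_incl n k ` Sp k) \<le> 3"
proof -
  have "k = Suc (Suc (k - 2))" using assms(1) by simp
  then obtain m where k: "k = Suc (Suc m)" ..
  have mn: "Suc m < n" "k \<le> n" "n - k = m" using assms(2) k by auto
  (* Each of the four indices stands for one choice of the two signs. *)
  define U where "U i = categorical_set n m (if i < 2 then 1 else - 1) (if even i then 1 else - 1)" for i :: nat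
  have "\<forall>i\<le>3. openin (stiefel_space n k) (U i) \<and> contractible_in (stiefel_space n k) (U i)"
    unfolding k U_def
    by (intro allI impI conjI openin_categorical_set contractible_categorical_set mn) auto
  moreover have "stiefel_incl n k ` Sp k \<subseteq> (\<Union>i\<le>3. U i)"
  proof
    fix x assume "x \<in> stiefel_incl n k ` Sp k"
    then obtain P where P: "P \<in> Sp k" and x: "x = stiefel_incl n k P" by blast
    have "x \<in> stiefel n (Suc (Suc m))" using stiefel_incl_Sp [OF P mn(2)] x k by simp
    moreover have "x $$ (i, j) = 0" if "i < m" "j < Suc (Suc m)" for i j
      using P that mn k by (subst x, subst stiefel_incl_entry) (auto simp: Sp_def)
    ultimately obtain s t where "s \<in> {1, -1}" "t \<in> {1, -1}" "x \<in> categorical_set n m s t"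
      using categorical_sets_cover [OF mn(1)] by blast
    then have "x \<in> U 0 \<or> x \<in> U 1 \<or> x \<in> U 2 \<or> x \<in> U 3" by (auto simp: U_def)
    then show "x \<in> (\<Union>i\<le>3. U i)" by force
  qed
  ultimately have "subspace_cat (stiefel_space n k) (stiefel_incl n k ` Sp k) \<le> enat 3"
    unfolding subspace_cat_def by (intro Inf_lower) blast
  then show ?thesis by (simp add: numeral_eq_enat)
qed

end
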